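(* Let $\boldsymbol{Q}\in\mathbb{R}^{dn\times dn}$ be a positive definite block-factorizable matrix defined by $\{\boldsymbol{U}_i\}_{i\in[n]}$ and $\{\boldsymbol{V}_i\}_{i\in[n]}$ in $\mathbb{R}^{d\times d}$, with associated matrices $\boldsymbol{\Lambda}_{[i\to j]}$, $1\le i<j\le n+1$, and let $$X^B_{\boldsymbol{Q}}:=\left\{(\boldsymbol{x},\boldsymbol{z},\tau)\in\mathbb{R}^{dn}\times\{0,1\}^n\times\mathbb{R}_+:\ \tau\ge\boldsymbol{x}^\top\boldsymbol{Q}\boldsymbol{x},\ \boldsymbol{x}_{[i]}(1-z_i)=\boldsymbol{0},\ i\in[n]\right\}.$$ Then $\mathrm{cl}\,\mathrm{conv}(X^B_{\boldsymbol{Q}})$ is the set of all $(\boldsymbol{x},\boldsymbol{z},\tau)\in\mathbb{R}^{(d+1)n+1}$ for which there exist $\boldsymbol{W}\in\mathbb{R}^{dn\times dn}$ and $\boldsymbol{w}=(w_{ij})_{0\le i<j\le n+1}\in\mathbb{R}_+^{(n+1)(n+2)/2}$ such that $$\begin{bmatrix}\boldsymbol{W}&\boldsymbol{x}\\ \boldsymbol{x}^\top&\tau\end{bmatrix}\succeq\boldsymbol{0},\qquad \boldsymbol{W}=\sum_{i=1}^n\sum_{j=i+1}^{n+1}\boldsymbol{\Lambda}_{[i\to j]}w_{ij},\qquad z_\ell=\sum_{i=0}^{\ell-1}w_{i\ell},\ \ \ell\in[n],$$ $$\sum_{i=0}^{\ell-1}w_{i\ell}-\sum_{j=\ell+1}^{n+1}w_{\ell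 j}=\begin{cases}-1&\text{if }\ell=0\\ 1&\text{if }\ell=n+1\\ 0&\text{otherwise}\end{cases}\qquad \ell\in\{0,\dots,n+1\}.$$
   Context: $[n]=\{1,\dots,n\}$; $\mathrm{cl}\,\mathrm{conv}$ denotes the closure of the convex hull. A vector $\boldsymbol{x}\in\mathbb{R}^{dn}$ is viewed as $n$ consecutive subvectors $\boldsymbol{x}_{[i]}\in\mathbb{R}^d$, and matrices in $\mathbb{R}^{dn\times dn}$ have $n^2$ blocks of size $d\times d$. $\boldsymbol{E}_i\in\mathbb{R}^{dn\times d}$ is the block column whose $i$-th $d\times d$ block is the identity and whose other blocks are zero. A symmetric matrix $\boldsymbol{Q}\in\mathbb{R}^{dn\times dn}$ is block-factorizable, defined by $\{\boldsymbol{U}_i\}_{i\in[n]}$, $\{\boldsymbol{V}_i\}_{i\in[n]}\subset\mathbb{R}^{d\times d}$, if its $(i,j)$-th block is $\boldsymbol{U}_i\boldsymbol{V}_j^\top$ for all $i\le j$. When $\boldsymbol{Q}$ is positive definite, $\boldsymbol{U}_i\boldsymbol{V}_i^\top\succ\boldsymbol{0}$ for all $i$ (so $\boldsymbol{U}_i,\boldsymbol{V}_i$ are nonsingular) and $\boldsymbol{U}_i\boldsymbol{V}_i^\top-\boldsymbol{U}_i\boldsymbol{U}_j^{-1}\boldsymbol{V}_j\boldsymbol{U}_i^\top\succ\boldsymbol{0}$ for all $i<j$, so the following matrices are well defined: $$\boldsymbol{\Lambda}_{[i\to j]}:=\left(\boldsymbol{E}_i-\boldsymbol{E}_j\boldsymbol{U}_j^{-\top}\boldsymbol{U}_i^\top\right)\left(\boldsymbol{U}_i\boldsymbol{V}_i^\top-\boldsymbol{U}_i\boldsymbol{U}_j^{-1}\boldsymbol{V}_j\boldsymbol{U}_i^\top\right)^{-1}\left(\boldsymbol{E}_i-\boldsymbol{E}_j\boldsymbol{U}_j^{-\top}\boldsymbol{U}_i^\top\right)^\top,\quad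 1\le i<j\le n,$$ $$\boldsymbol{\Lambda}_{[i\to n+1]}:=\boldsymbol{E}_i\left(\boldsymbol{U}_i\boldsymbol{V}_i^\top\right)^{-1}\boldsymbol{E}_i^\top,\quad 1\le i\le n.$$ *)

theory Defs
  imports "HOL-Analysis.Analysis"
begin

(* The space R^{dn} is rendered as real^('n \<times> 'd), with n = CARD('n) and d = CARD('d):
   the coordinate (i, k) is the k-th entry of the i-th subvector. The linear order on 'n
   provides the numbering 1, ..., n of the blocks. *)

(* 1-based; only meaningful for arguments in {1..CARD('n)} *)
definition idx :: "nat \<Rightarrow> 'n::{finite,linorder}" where
  "idx i = sorted_list_of_set (UNIV :: 'n set) ! (i - 1)"

lemma bij_betw_idx:
  "bij_betw (idx :: nat \<Rightarrow> 'n::{finite,linorder}) {1..CARD('n)} UNIV"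
proof -
  have "bij_betw (\<lambda>i. i - 1) {1..CARD('n)} {..<CARD('n)}"
    by (rule bij_betw_byWitness[where f' = Suc]) (auto simp: image_subset_iff)
  moreover have "bij_betw ((!) (sorted_list_of_set (UNIV :: 'n set))) {..<CARD('n)} UNIV"
    by (rule bij_betw_nth) auto
  ultimately have "bij_betw ((!) (sorted_list_of_set (UNIV :: 'n set)) \<circ> (\<lambda>i. i - 1))
      {1..CARD('n)} UNIV"
    by (rule bij_betw_trans)
  then show ?thesis
    by (simp add: idx_def[abs_def] comp_def)
qed

lemma idx_less:
  assumes "1 \<le> i" "i < j" "j \<le> CARD('n)"
  shows "(idx i :: 'n::{finite,linorder}) < idx j"
  using assms strict_sorted_list_of_set[of "UNIV :: 'n set"]
  by (auto simp: idx_def sorted_wrt_iff_nth_less)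

definition subvec :: "real^('n::{finite,linorder} \<times> 'd::finite) \<Rightarrow> nat \<Rightarrow> real^'d"
  where "subvec x i = (\<chi> k. x $ (idx i, k))"

definition block :: "real^('n::{finite,linorder} \<times> 'd::finite)^('n \<times> 'd) \<Rightarrow> nat \<Rightarrow> nat \<Rightarrow> real^'d^'d"
  where "block A i j = (\<chi> k l. A $ (idx i, k) $ (idx j, l))"

definition block_unit :: "nat \<Rightarrow> real^'d::finite^('n::{finite,linorder} \<times> 'd)"
  where "block_unit i = (\<chi> p q. if p = (idx i, q) then 1 else 0)"

definition pos_semidef :: "real^'m^'m::finite \<Rightarrow> bool"
  where "pos_semidef A \<longleftrightarrow> transpose A = A \<and> (\<forall>v. 0 \<le> v \<bullet> (A *v v))"

definition pos_def :: "real^'m^'m::finite \<Rightarrow> bool"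
  where "pos_def A \<longleftrightarrow> transpose A = A \<and> (\<forall>v. v \<noteq> 0 \<longrightarrow> 0 < v \<bullet> (A *v v))"

definition block_factorizable ::
  "real^('n::{finite,linorder} \<times> 'd)^('n \<times> 'd) \<Rightarrow>
    (nat \<Rightarrow> real^'d^'d::finite) \<Rightarrow> (nat \<Rightarrow> real^'d^'d) \<Rightarrow> bool"
  where "block_factorizable Q U V \<longleftrightarrow> transpose Q = Q \<and>
    (\<forall>i j. 1 \<le> i \<and> i \<le> j \<and> j \<le> CARD('n) \<longrightarrow> block Q i j = U i ** transpose (V j))"

(* Meant for 1 \<le> i < j \<le> CARD('n) + 1, so the second branch is j = CARD('n) + 1. *)
definition Lam ::
  "(nat \<Rightarrow> real^'d^'d::finite) \<Rightarrow> (nat \<Rightarrow> real^'d^'d) \<Rightarrow> nat \<Rightarrow> nat \<Rightarrow>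
    real^('n::{finite,linorder} \<times> 'd)^('n \<times> 'd)"
  where "Lam U V i j =
    (if j \<le> CARD('n) then
       let B = block_unit i
               - block_unit j ** (matrix_inv (transpose (U j)) ** transpose (U i))
       in B ** matrix_inv (U i ** transpose (V i)
                 - U i ** matrix_inv (U j) ** V j ** transpose (U i)) ** transpose B
     else block_unit i ** matrix_inv (U i ** transpose (V i)) ** transpose (block_unit i))"

definition XB ::
  "real^('n::{finite,linorder} \<times> 'd::finite)^('n \<times> 'd) \<Rightarrow>
    ((real^('n \<times> 'd)) \<times> (real^'n::{finite,linorder}) \<times> real) set"
  where "XB Q = {(x, z, \<tau>). (\<forall>i\<in>{1..CARD('n)}. z $ idx i \<in> {0, 1}) \<and> 0 \<le> \<tau> \<and>
    x \<bullet> (Q *v x) \<le> \<tau> \<and>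
    (\<forall>i\<in>{1..CARD('n)}. (1 - z $ idx i) *\<^sub>R subvec x i = 0)}"

(* The matrix [W, x; x^T, t]; the index None is the last row and column. *)
definition bordered ::
  "real^'m^'m::finite \<Rightarrow> real^'m \<Rightarrow> real \<Rightarrow> real^('m option)^('m option)"
  where "bordered W x t = (\<chi> p q. case (p, q) of
      (Some i, Some j) \<Rightarrow> W $ i $ j
    | (Some i, None) \<Rightarrow> x $ i
    | (None, Some j) \<Rightarrow> x $ j
    | (None, None) \<Rightarrow> t)"

end

theory Submission
  imports Defs
begin

text \<open>For a support \<open>S\<close>, the extension by zero of the inverse of the principal block submatrix \<open>Q\<^sub>S\<close> is
  the sum of the matrices \<open>Lam U V i j\<close> over consecutive indices \<open>i < j\<close> of \<open>S\<close>, with \<open>n + 1\<close> appended: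
  supports are paths from \<open>0\<close> to \<open>n + 1\<close>, the matrix is additive along the path, and convex combinations
  of paths are unit flows. The hull itself is obtained from the Schur complement: a point of \<open>XB Q\<close> with
  support \<open>S\<close> is a vector in the range of the extended inverse \<open>W\<close>, with \<open>\<tau>\<close> at least the cost given
  by the pseudoinverse of \<open>W\<close>, and averaging over supports gives the condition on the bordered matrix.
  Closedness holds because flows form a polytope.\<close>

section \<open>Paths and unit flows\<close>

text \<open>The relation keeps only the total of the weights \<open>a\<close> along some strictly
  increasing path from \<open>i\<close> to \<open>N\<close>. Weights lie in any real vector space,
  so one path can carry a matrix and a support indicator together.\<close>

inductive path_value :: "(nat \<Rightarrow> nat \<Rightarrow> 'a::real_vector) \<Rightarrow> nat \<Rightarrow> nat \<Rightarrow> 'a \<Rightarrow> bool"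
  for a N where
  path_value_end: "path_value a N N 0"
| path_value_step: "i < j \<Longrightarrow> path_value a N j v \<Longrightarrow> path_value a N i (a i j + v)"

lemma path_value_le: "path_value a N i v \<Longrightarrow> i \<le> N"
  by (induction rule: path_value.induct) auto

lemma ex_path_value:
  assumes "i \<le> N"
  shows "\<exists>v. path_value a N i v"
proof (cases "i = N")
  case True
  then show ?thesis using path_value_end by blast
next
  case False
  then have "i < N" using assms by simp
  then show ?thesis using path_value_step path_value_end by blast
qed

text \<open>Nodes increase strictly, so there are finitely many paths. This makes the hull of the
  values compact.\<close>

lemma finite_path_values: "finite {v. path_value a N i v}"
proof (induction "N - i" arbitrary: i rule: less_induct)
  case less
  have "{v. path_value a N i v} \<subseteq> insert 0 (\<Union>j\<in>{i<..N}. (+) (a i j) ` {v. path_value a N j v})"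
    (is "_ \<subseteq> ?B")
  proof
    fix v assume "v \<in> {v. path_value a N i v}"
    then have "path_value a N i v" by simp
    then show "v \<in> ?B"
      by (cases rule: path_value.cases) (use path_value_le in force)+
  qed
  moreover have "finite ?B"
    using less by auto
  ultimately show ?case
    by (rule finite_subset)
qed

text \<open>A variable source \<open>s\<close> lets flows be built along a path from its end; at
  \<open>s = N\<close> the two indicators cancel and the zero flow qualifies.\<close>

definition unit_flow :: "nat \<Rightarrow> nat \<Rightarrow> (nat \<Rightarrow> nat \<Rightarrow> real) \<Rightarrow> bool" where
  "unit_flow N s w \<longleftrightarrow> (\<forall>i j. i < j \<and> j \<le> N \<longrightarrow> 0 \<le> w i j) \<and>
    (\<forall>k\<in>{0..N}. (\<Sum>i<k. w i k) - (\<Sum>j=k+1..N. w k j) = of_bool (k = N) - of_bool (k = s))"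

definition flow_value :: "(nat \<Rightarrow> nat \<Rightarrow> 'a::real_vector) \<Rightarrow> nat \<Rightarrow> (nat \<Rightarrow> nat \<Rightarrow> real) \<Rightarrow> 'a" where
  "flow_value a N w = (\<Sum>i<N. \<Sum>j=i+1..N. w i j *\<^sub>R a i j)"

text \<open>No decomposition into paths is made: the weights \<open>a i j\<close> are replaced by
  differences of mean values \<open>q\<close>, and conservation collapses the sum to
  \<open>q s - q N\<close>, where \<open>q N = 0\<close>.\<close>

lemma flow_value_in_hull:
  assumes flow: "unit_flow N s w" and "s \<le> N"
  shows "flow_value a N w \<in> convex hull {v. path_value a N s v}"
proof -
  let ?P = "\<lambda>k. convex hull {v. path_value a N k v}"
  define out where "out k = (\<Sum>j=k+1..N. w k j)" for k
  have nonneg: "0 \<le> w i j" if "i < j" "j \<le> N" for i j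
    using flow that by (auto simp: unit_flow_def)
  \<comment> \<open>\<open>q k\<close> is the mean value of the paths from \<open>k\<close> that leave each node in proportion to \<open>w\<close>.\<close>
  have "\<exists>q. \<forall>k. m \<le> k \<and> k \<le> N \<longrightarrow> q k \<in> ?P k \<and> (k = N \<longrightarrow> q k = 0) \<and>
      (k < N \<longrightarrow> out k *\<^sub>R q k = (\<Sum>j=k+1..N. w k j *\<^sub>R (a k j + q j)))" if "m \<le> N" for m
    using that
  proof (induction m rule: inc_induct)
    case base
    have "(0::'a) \<in> ?P N"
      by (rule hull_inc) (simp add: path_value_end)
    then show ?case
      by (intro exI[of _ "\<lambda>_. 0"]) (auto simp: le_less)
  next
    case (step m)
    then obtain q where q: "\<And>k. Suc m \<le> k \<Longrightarrow> k \<le> N \<Longrightarrow> q k \<in> ?P k \<and> (k = N \<longrightarrow> q k = 0) \<and>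
      (k < N \<longrightarrow> out k *\<^sub>R q k = (\<Sum>j=k+1..N. w k j *\<^sub>R (a k j + q j)))"
      by blast
    have "\<exists>r. r \<in> ?P m \<and> out m *\<^sub>R r = (\<Sum>j=m+1..N. w m j *\<^sub>R (a m j + q j))"
    \<comment> \<open>If nothing leaves \<open>m\<close>, the averaging equation reads
      \<open>0 = 0\<close> and the value of any path from \<open>m\<close> will do.\<close>
    proof (cases "out m = 0")
      case True
      then have "w m j = 0" if "j \<in> {m+1..N}" for j
        using that nonneg unfolding out_def by (subst (asm) sum_nonneg_eq_0_iff) auto
      moreover obtain v where "path_value a N m v"
        using ex_path_value step.hyps by (meson less_imp_le)
      ultimately show ?thesis
        using True by (intro exI[of _ v]) (auto intro: hull_inc)
    next
      case False
      have "0 \<le> out m"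
        unfolding out_def using nonneg by (intro sum_nonneg) auto
      then have pos: "out m > 0" using False by simp
      let ?r = "\<Sum>j=m+1..N. (w m j / out m) *\<^sub>R (a m j + q j)"
      \<comment> \<open>Prepending the arc from \<open>m\<close> to \<open>j\<close> translates the
        values of paths from \<open>j\<close> by \<open>a m j\<close>.\<close>
      have mem: "a m j + q j \<in> ?P m" if "j \<in> {m+1..N}" for j
      proof -
        have "a m j + q j \<in> (+) (a m j) ` ?P j"
          using q that by auto
        also have "\<dots> = convex hull ((+) (a m j) ` {v. path_value a N j v})"
          by (simp add: convex_hull_translation)
        also have "\<dots> \<subseteq> ?P m"
          using that by (intro hull_mono) (auto intro: path_value_step)
        finally show ?thesis .
      qed
      have "?r \<in> ?P m"
        using nonneg pos mem
        by (intro convex_sum) (auto simp: sum_divide_distrib[symmetric] out_def)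
      moreover have "out m *\<^sub>R ?r = (\<Sum>j=m+1..N. w m j *\<^sub>R (a m j + q j))"
        using pos by (simp add: scaleR_sum_right)
      ultimately show ?thesis by blast
    qed
    then obtain r where r: "r \<in> ?P m" "out m *\<^sub>R r = (\<Sum>j=m+1..N. w m j *\<^sub>R (a m j + q j))"
      by blast
    show ?case
    proof (intro exI[of _ "q(m := r)"] allI impI)
      fix k assume k: "m \<le> k \<and> k \<le> N"
      have *: "(\<Sum>j=k+1..N. w k j *\<^sub>R (a k j + (q(m := r)) j)) = (\<Sum>j=k+1..N. w k j *\<^sub>R (a k j + q j))"
        using k by (intro sum.cong) auto
      show "(q(m := r)) k \<in> ?P k \<and> (k = N \<longrightarrow> (q(m := r)) k = 0) \<and>
        (k < N \<longrightarrow> out k *\<^sub>R (q(m := r)) k = (\<Sum>j=k+1..N. w k j *\<^sub>R (a k j + (q(m := r)) j)))"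
        unfolding * using r q[of k] k step.hyps by (cases "k = m") auto
    qed
  qed
  from this[of 0] obtain q where *: "\<And>k. k \<le> N \<Longrightarrow> q k \<in> ?P k \<and> (k = N \<longrightarrow> q k = 0) \<and>
      (k < N \<longrightarrow> out k *\<^sub>R q k = (\<Sum>j=k+1..N. w k j *\<^sub>R (a k j + q j)))"
    by blast
  have q: "\<And>k. k \<le> N \<Longrightarrow> q k \<in> ?P k" "q N = 0"
    "\<And>k. k < N \<Longrightarrow> out k *\<^sub>R q k = (\<Sum>j=k+1..N. w k j *\<^sub>R (a k j + q j))"
    using * *[of N] by simp_all
  have "flow_value a N w = (\<Sum>i<N. out i *\<^sub>R q i) - (\<Sum>i<N. \<Sum>j=i+1..N. w i j *\<^sub>R q j)"
    unfolding flow_value_def sum_subtractf[symmetric]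
    by (intro sum.cong) (auto simp: q(3) scaleR_add_right sum.distrib)
  \<comment> \<open>Grouping the arcs by head turns the subtracted sum into inflows.\<close>
  also have "(\<Sum>i<N. \<Sum>j=i+1..N. w i j *\<^sub>R q j) = (\<Sum>k\<le>N. (\<Sum>i<k. w i k) *\<^sub>R q k)"
    by (simp add: sum.nested_swap'[symmetric] scaleR_sum_left)
  also have "(\<Sum>i<N. out i *\<^sub>R q i) = (\<Sum>k\<le>N. out k *\<^sub>R q k)"
    by (simp add: lessThan_Suc_atMost[symmetric] q(2))
  also have "(\<Sum>k\<le>N. out k *\<^sub>R q k) - (\<Sum>k\<le>N. (\<Sum>i<k. w i k) *\<^sub>R q k)
      = (\<Sum>k\<le>N. (of_bool (k = s) - of_bool (k = N)) *\<^sub>R q k)"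
    unfolding sum_subtractf[symmetric] scaleR_diff_left[symmetric]
  proof (intro sum.cong refl arg_cong2[where f = scaleR])
    fix k assume "k \<in> {..N}"
    then have "(\<Sum>i<k. w i k) - out k = of_bool (k = N) - of_bool (k = s)"
      using flow by (auto simp: unit_flow_def out_def)
    then show "out k - (\<Sum>i<k. w i k) = of_bool (k = s) - of_bool (k = N)"
      by simp
  qed
  also have "\<dots> = q s"
    using \<open>s \<le> N\<close> q(2)
    by (simp add: scaleR_diff_left sum_subtractf of_bool_def if_distrib[of "\<lambda>c. c *\<^sub>R _"] sum.delta cong: if_cong)
  finally show ?thesis
    using q(1) \<open>s \<le> N\<close> by simp
qed

lemma path_value_is_flow_value:
  assumes "path_value a N s v"
  shows "\<exists>w. unit_flow N s w \<and> flow_value a N w = v"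
  using assms
proof (induction rule: path_value.induct)
  case path_value_end
  show ?case
    by (rule exI[of _ "\<lambda>_ _. 0"]) (simp add: unit_flow_def flow_value_def)
next
  case (path_value_step s t v)
  then obtain w where w: "unit_flow N t w" "flow_value a N w = v" by blast
  have "t \<le> N" using path_value_step path_value_le by blast
  \<comment> \<open>\<open>u\<close> is the unit flow on the single arc from \<open>s\<close> to
    \<open>t\<close>; adding it to \<open>w\<close> moves the source from \<open>t\<close> to
    \<open>s\<close>.\<close>
  define u where "u i j = (of_bool (i = s \<and> j = t) :: real)" for i j
  have o: "(\<Sum>j=k+1..N. u k j) = of_bool (k = s)" for k
    using \<open>t \<le> N\<close> \<open>s < t\<close> by (cases "k = s") (auto simp: u_def of_bool_def sum.delta)
  have i: "(\<Sum>i<k. u i k) = of_bool (k = t)" for k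
    using \<open>s < t\<close> by (cases "k = t") (auto simp: u_def of_bool_def sum.delta)
  have "(\<Sum>j=k+1..N. u k j *\<^sub>R a k j) = (if k = s then a s t else 0)" for k
    using \<open>t \<le> N\<close> \<open>s < t\<close>
    by (cases "k = s") (auto simp: u_def of_bool_def if_distrib[of "\<lambda>c. c *\<^sub>R _"] sum.delta cong: if_cong)
  then have "flow_value a N u = a s t"
    using \<open>t \<le> N\<close> \<open>s < t\<close> by (simp add: flow_value_def sum.delta)
  then have "flow_value a N (\<lambda>i j. u i j + w i j) = a s t + v"
    using w(2) by (simp add: flow_value_def scaleR_add_left sum.distrib)
  moreover have "unit_flow N s (\<lambda>i j. u i j + w i j)"
    using w(1) unfolding unit_flow_def sum.distrib i o
    by (auto simp: u_def)
  ultimately show ?case by blast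
qed

text \<open>Flows are closed under convex combinations and their value is linear, so it suffices to
  realize each path. The hull thereby becomes a linear system in \<open>w\<close>.\<close>

lemma unit_flow_values:
  assumes "s \<le> N"
  shows "{flow_value a N w |w. unit_flow N s w} = convex hull {v. path_value a N s v}"
proof
  show "{flow_value a N w |w. unit_flow N s w} \<subseteq> convex hull {v. path_value a N s v}"
    using flow_value_in_hull[OF _ assms] by blast
  have "convex {flow_value a N w |w. unit_flow N s w}"
  proof (rule convexI)
    fix x y and c d :: real
    assume cd: "0 \<le> c" "0 \<le> d" "c + d = 1"
    assume "x \<in> {flow_value a N w |w. unit_flow N s w}" "y \<in> {flow_value a N w |w. unit_flow N s w}"
    then obtain w w' where w: "unit_flow N s w" "x = flow_value a N w"
      "unit_flow N s w'" "y = flow_value a N w'" by blast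
    let ?w = "\<lambda>i j. c * w i j + d * w' i j"
    have "c *\<^sub>R x + d *\<^sub>R y = flow_value a N ?w"
      by (simp add: w flow_value_def scaleR_sum_right scaleR_add_left sum.distrib)
    moreover have "unit_flow N s ?w"
      unfolding unit_flow_def
    proof (intro conjI ballI allI impI)
      fix k assume "k \<in> {0..N}"
      then have *: "(\<Sum>i<k. w i k) - (\<Sum>j=k+1..N. w k j) = of_bool (k = N) - of_bool (k = s)"
        "(\<Sum>i<k. w' i k) - (\<Sum>j=k+1..N. w' k j) = of_bool (k = N) - of_bool (k = s)"
        using w by (auto simp: unit_flow_def)
      have "(\<Sum>i<k. ?w i k) - (\<Sum>j=k+1..N. ?w k j) =
          c * ((\<Sum>i<k. w i k) - (\<Sum>j=k+1..N. w k j)) + d * ((\<Sum>i<k. w' i k) - (\<Sum>j=k+1..N. w' k j))"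
        by (simp add: sum.distrib sum_distrib_left algebra_simps)
      also have "\<dots> = of_bool (k = N) - of_bool (k = s)"
        unfolding * by (simp add: distrib_right[symmetric] cd)
      finally show "(\<Sum>i<k. ?w i k) - (\<Sum>j=k+1..N. ?w k j) = of_bool (k = N) - of_bool (k = s)" .
    qed (use w cd in \<open>auto simp: unit_flow_def\<close>)
    ultimately show "c *\<^sub>R x + d *\<^sub>R y \<in> {flow_value a N w |w. unit_flow N s w}" by blast
  qed
  then show "convex hull {v. path_value a N s v} \<subseteq> {flow_value a N w |w. unit_flow N s w}"
    using path_value_is_flow_value[of a N s] by (intro hull_minimal) blast+
qed

section \<open>Bordered positive semidefinite matrices\<close>

text \<open>A vector indexed by the option type splits into \<open>v\<close>, its
  \<open>Some\<close> part, and \<open>s\<close>, its \<open>None\<close> entry.\<close>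

lemma pos_semidef_bordered_iff:
  "pos_semidef (bordered W x t) \<longleftrightarrow> transpose W = W \<and>
    (\<forall>v s. 0 \<le> v \<bullet> (W *v v) + 2 * s * (x \<bullet> v) + s * s * t)"
proof -
  have sum_option: "(\<Sum>p\<in>UNIV. f p) = f None + (\<Sum>i\<in>UNIV. f (Some i))" for f :: "'a option \<Rightarrow> real"
    by (simp add: UNIV_option_conv sum.reindex)
  have quad: "u \<bullet> (bordered W x t *v u) =
      (\<chi> i. u $ Some i) \<bullet> (W *v (\<chi> i. u $ Some i)) + 2 * u $ None * (x \<bullet> (\<chi> i. u $ Some i))
        + u $ None * u $ None * t" for u
    by (simp add: inner_vec_def matrix_vector_mult_def bordered_def sum_option sum.distrib
        sum_distrib_left algebra_simps)
  have "(\<forall>u. 0 \<le> u \<bullet> (bordered W x t *v u)) \<longleftrightarrow>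
      (\<forall>v s. 0 \<le> v \<bullet> (W *v v) + 2 * s * (x \<bullet> v) + s * s * t)"
  proof (intro iffI allI)
    fix v s
    assume "\<forall>u. 0 \<le> u \<bullet> (bordered W x t *v u)"
    then have "0 \<le> (\<chi> p. case p of None \<Rightarrow> s | Some i \<Rightarrow> v $ i) \<bullet>
        (bordered W x t *v (\<chi> p. case p of None \<Rightarrow> s | Some i \<Rightarrow> v $ i))" by blast
    then show "0 \<le> v \<bullet> (W *v v) + 2 * s * (x \<bullet> v) + s * s * t"
      by (simp add: quad)
  qed (simp add: quad)
  moreover have "transpose (bordered W x t) = bordered W x t \<longleftrightarrow> transpose W = W"
    unfolding vec_eq_iff transpose_def by (auto simp: bordered_def split: option.split)
  ultimately show ?thesis
    by (simp add: pos_semidef_def)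
qed

lemma symmetric_matrix_inner:
  fixes W :: "real^'m^'m"
  assumes "transpose W = W"
  shows "(W *v u) \<bullet> v = u \<bullet> (W *v v)"
  by (metis assms dot_lmul_matrix vector_transpose_matrix)

text \<open>Completing the square: the form is that of \<open>W\<close> at
  \<open>v + s *\<^sub>R y\<close> plus \<open>s * s\<close> times the slack
  \<open>t - y \<bullet> (W *v y)\<close>.\<close>

lemma pos_semidef_bordered_mult:
  assumes "pos_semidef W" "y \<bullet> (W *v y) \<le> t"
  shows "pos_semidef (bordered W (W *v y) t)"
  unfolding pos_semidef_bordered_iff
proof (intro conjI allI)
  show sym: "transpose W = W" using assms by (simp add: pos_semidef_def)
  fix v :: "real^'a" and s :: real
  have "(W *v y) \<bullet> v = v \<bullet> (W *v y)" "y \<bullet> (W *v v) = v \<bullet> (W *v y)"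
    by (metis inner_commute symmetric_matrix_inner[OF sym])+
  moreover have "0 \<le> (v + s *\<^sub>R y) \<bullet> (W *v (v + s *\<^sub>R y))"
    using assms by (simp add: pos_semidef_def)
  ultimately have "0 \<le> v \<bullet> (W *v v) + 2 * s * ((W *v y) \<bullet> v) + s * s * (y \<bullet> (W *v y))"
    by (simp add: matrix_vector_right_distrib matrix_vector_mult_scaleR inner_add algebra_simps)
  also have "\<dots> \<le> v \<bullet> (W *v v) + 2 * s * ((W *v y) \<bullet> v) + s * s * t"
    using assms(2) by (simp add: mult_left_mono)
  finally show "0 \<le> v \<bullet> (W *v v) + 2 * s * ((W *v y) \<bullet> v) + s * s * t" .
qed

text \<open>This is the Schur complement condition, with a preimage \<open>y\<close> of
  \<open>x\<close> in place of the pseudoinverse of \<open>W\<close> applied to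
  \<open>x\<close>.\<close>

lemma pos_semidef_borderedE:
  assumes "pos_semidef (bordered W x t)"
  obtains y where "x = W *v y" "y \<bullet> (W *v y) \<le> t"
proof -
  have sym: "transpose W = W" and psd: "\<And>v s. 0 \<le> v \<bullet> (W *v v) + 2 * s * (x \<bullet> v) + s * s * t"
    using assms by (auto simp: pos_semidef_bordered_iff)
  note selfadj = symmetric_matrix_inner[OF sym]
  have ker: "x \<bullet> v = 0" if "W *v v = 0" for v
  proof (rule ccontr)
    assume "x \<bullet> v \<noteq> 0"
    define c where "c = x \<bullet> v"
    have t: "0 \<le> t" using psd[of 0 1] by simp
    have "0 \<le> 2 * s * c + s * s * t" for s
      using psd[of v s] that by (simp add: c_def)
    \<comment> \<open>For small \<open>s\<close> of sign opposite to \<open>c\<close> the linear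
      term dominates; \<open>t + 1\<close> keeps the denominator positive when
      \<open>t = 0\<close>.\<close>
    from this[of "- c / (t + 1)"] have "0 \<le> c\<^sup>2 * (t / (t + 1)\<^sup>2 - 2 / (t + 1))"
      by (simp add: power2_eq_square field_simps)
    moreover have "t / (t + 1)\<^sup>2 - 2 / (t + 1) < 0"
      using t by (simp add: power2_eq_square divide_simps)
    ultimately show False
      using \<open>x \<bullet> v \<noteq> 0\<close> by (simp add: c_def zero_le_mult_iff)
  qed
  have sub: "subspace (range ((*v) W))"
    by (intro linear_subspace_image matrix_vector_mul_linear subspace_UNIV)
  \<comment> \<open>The part \<open>q\<close> of \<open>x\<close> orthogonal to the range of
    \<open>W\<close> lies in the kernel by symmetry, and \<open>ker\<close> forces it to
    vanish.\<close>
  obtain p q where p: "p \<in> span (range ((*v) W))" and q: "\<And>u. u \<in> span (range ((*v) W)) \<Longrightarrow> orthogonal q u"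
    and x: "x = p + q"
    using orthogonal_subspace_decomp_exists by blast
  have span: "span (range ((*v) W)) = range ((*v) W)" using sub by (simp add: span_eq_iff)
  have "(W *v q) \<bullet> u = 0" for u
    using q[of "W *v u"] by (simp add: span selfadj orthogonal_def)
  then have "W *v q = 0" by (metis inner_eq_zero_iff)
  then have "x \<bullet> q = 0" by (rule ker)
  moreover have "p \<bullet> q = 0" using q[OF p] by (simp add: orthogonal_def inner_commute)
  ultimately have "q = 0" by (simp add: x inner_add_left)
  then obtain y where y: "x = W *v y" using p x span by auto
  show ?thesis
  proof
    show "y \<bullet> (W *v y) \<le> t"
      using psd[of y "-1"] by (simp add: y selfadj)
  qed (fact y)
qed

text \<open>The set is posed as a relation between \<open>(W, z)\<close>, later confined to a
  compact polytope, and the point \<open>(x, z', t)\<close>, so that projecting out the compact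
  factor preserves closedness.\<close>

lemma closed_pos_semidef_bordered:
  "closed {((W :: real^'m^'m::finite, z :: 'z::t2_space), (x, z', t)). z = z' \<and> pos_semidef (bordered W x t)}"
proof -
  have "closed {p :: ((real^'m^'m) \<times> 'z) \<times> (real^'m) \<times> 'z \<times> real.
      snd (fst p) = fst (snd (snd p)) \<and> (\<forall>i j. fst (fst p) $ i $ j = fst (fst p) $ j $ i) \<and>
      (\<forall>v s. 0 \<le> v \<bullet> (fst (fst p) *v v) + 2 * s * (fst (snd p) \<bullet> v) + s * s * snd (snd (snd p)))}"
    unfolding matrix_vector_mult_def
    by (intro closed_Collect_conj closed_Collect_all closed_Collect_eq closed_Collect_le continuous_intros)
  moreover have "transpose W = W \<longleftrightarrow> (\<forall>i j. W $ i $ j = W $ j $ i)" for W :: "real^'m^'m"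
    by (auto simp: transpose_def vec_eq_iff)
  ultimately show ?thesis
    by (elim back_subst[of closed]) (auto simp: pos_semidef_bordered_iff)
qed

text \<open>For fixed \<open>v\<close> and \<open>s\<close> the form is linear in \<open>W\<close>,
  \<open>x\<close> and \<open>t\<close>.\<close>

lemma convex_pos_semidef_bordered:
  assumes "convex K"
  shows "convex {(x, z, t). \<exists>W. (W, z) \<in> K \<and> pos_semidef (bordered W x t)}"
proof (rule convexI)
  fix p q and c d :: real
  assume cd: "0 \<le> c" "0 \<le> d" "c + d = 1"
  assume p: "p \<in> {(x, z, t). \<exists>W. (W, z) \<in> K \<and> pos_semidef (bordered W x t)}"
    and q: "q \<in> {(x, z, t). \<exists>W. (W, z) \<in> K \<and> pos_semidef (bordered W x t)}"
  obtain x z t W where W: "p = (x, z, t)" "(W, z) \<in> K" "pos_semidef (bordered W x t)"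
    using p by auto
  obtain x' z' t' W' where W': "q = (x', z', t')" "(W', z') \<in> K" "pos_semidef (bordered W' x' t')"
    using q by auto
  have "c *\<^sub>R (W, z) + d *\<^sub>R (W', z') \<in> K"
    using assms W W' cd by (intro convexD)
  moreover have "pos_semidef (bordered (c *\<^sub>R W + d *\<^sub>R W') (c *\<^sub>R x + d *\<^sub>R x') (c * t + d * t'))"
    unfolding pos_semidef_bordered_iff
  proof (intro conjI allI)
    show "transpose (c *\<^sub>R W + d *\<^sub>R W') = c *\<^sub>R W + d *\<^sub>R W'"
      using W(3) W'(3) by (simp add: pos_semidef_bordered_iff transpose_def vec_eq_iff)
    fix v s
    have "0 \<le> c * (v \<bullet> (W *v v) + 2 * s * (x \<bullet> v) + s * s * t) +
        d * (v \<bullet> (W' *v v) + 2 * s * (x' \<bullet> v) + s * s * t')"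
      using W(3) W'(3) cd by (simp add: pos_semidef_bordered_iff)
    also have "\<dots> = v \<bullet> ((c *\<^sub>R W + d *\<^sub>R W') *v v) + 2 * s * ((c *\<^sub>R x + d *\<^sub>R x') \<bullet> v) + s * s * (c * t + d * t')"
      by (simp add: matrix_vector_mult_add_rdistrib scaleR_matrix_vector_assoc[symmetric] inner_add_left
          inner_add_right algebra_simps)
    finally show "0 \<le> v \<bullet> ((c *\<^sub>R W + d *\<^sub>R W') *v v) + 2 * s * ((c *\<^sub>R x + d *\<^sub>R x') \<bullet> v) + s * s * (c * t + d * t')" .
  qed
  ultimately show "c *\<^sub>R p + d *\<^sub>R q \<in> {(x, z, t). \<exists>W. (W, z) \<in> K \<and> pos_semidef (bordered W x t)}"
    using W(1) W'(1) by auto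
qed

section \<open>Block vectors and positive definite matrices\<close>

declare transpose_matrix_vector[simp del]


lemma idx_eq_iff:
  assumes "i \<in> {1..CARD('n)}" "j \<in> {1..CARD('n)}"
  shows "(idx i :: 'n::{finite,linorder}) = idx j \<longleftrightarrow> i = j"
  using assms inj_on_eq_iff bij_betw_imp_inj_on bij_betw_idx by metis

lemma ex_idx: "\<exists>i\<in>{1..CARD('n)}. (p :: 'n::{finite,linorder}) = idx i"
proof -
  have "p \<in> idx ` {1..CARD('n)}"
    by (simp only: bij_betw_imp_surj_on[OF bij_betw_idx] UNIV_I)
  then show ?thesis by blast
qed

lemma subvec_add: "subvec (x + y) i = subvec x i + subvec y i"
  and subvec_diff: "subvec (x - y) i = subvec x i - subvec y i"
  and subvec_scaleR: "subvec (c *\<^sub>R x) i = c *\<^sub>R subvec x i"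
  and subvec_zero: "subvec 0 i = 0"
  by (simp_all add: subvec_def vec_eq_iff)

lemma subvec_sum: "subvec (\<Sum>s\<in>S. f s) i = (\<Sum>s\<in>S. subvec (f s) i)"
  by (simp add: subvec_def vec_eq_iff)

lemmas subvec_linear = subvec_add subvec_diff subvec_scaleR subvec_zero

lemma vec_eq_subvecI:
  fixes x y :: "real^('n::{finite,linorder} \<times> 'd::finite)"
  assumes "\<And>i. i \<in> {1..CARD('n)} \<Longrightarrow> subvec x i = subvec y i"
  shows "x = y"
proof -
  have "x $ (p, k) = y $ (p, k)" for p k
  proof -
    obtain i where i: "i \<in> {1..CARD('n)}" "p = idx i" using ex_idx by blast
    then show ?thesis
      using assms[OF i(1)] by (auto simp: subvec_def vec_eq_iff)
  qed
  then show ?thesis by (auto simp: vec_eq_iff)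
qed

lemma block_unit_mult_nth: "(block_unit i *v u) $ p = (if fst p = idx i then u $ snd p else 0)"
  by (cases p) (auto simp: matrix_vector_mult_def block_unit_def if_distrib[of "\<lambda>c. c * _"] cong: if_cong)

lemma subvec_block_unit_mult:
  assumes "i \<in> {1..CARD('n)}" "j \<in> {1..CARD('n)}"
  shows "subvec (block_unit i *v u :: real^('n::{finite,linorder} \<times> 'd::finite)) j = (if i = j then u else 0)"
  using assms by (auto simp: subvec_def block_unit_mult_nth idx_eq_iff vec_eq_iff)

lemma transpose_block_unit_mult: "transpose (block_unit i) *v x = subvec x i"
proof -
  have "(\<Sum>q\<in>UNIV. (if q = (idx i, k) then 1 else 0) * x $ q) = x $ (idx i, k)" for k
    by (simp add: if_distrib[of "\<lambda>c. c * _"] cong: if_cong)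
  then show ?thesis
    by (simp add: matrix_vector_mult_def transpose_def block_unit_def subvec_def vec_eq_iff)
qed

lemma vec_eq_sum_block_unit:
  "x = (\<Sum>s=1..CARD('n). block_unit s *v subvec x s)"
  for x :: "real^('n::{finite,linorder} \<times> 'd::finite)"
proof (rule vec_eq_subvecI)
  fix i assume i: "i \<in> {1..CARD('n)}"
  have "subvec (\<Sum>s=1..CARD('n). block_unit s *v subvec x s :: real^('n \<times> 'd)) i =
      (\<Sum>s=1..CARD('n). subvec (block_unit s *v subvec x s :: real^('n \<times> 'd)) i)"
    by (rule subvec_sum)
  also have "\<dots> = (\<Sum>s=1..CARD('n). if s = i then subvec x s else 0)"
    using i by (intro sum.cong) (simp_all only: subvec_block_unit_mult)
  also have "\<dots> = subvec x i"
    using i by (simp add: sum.delta)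
  finally show "subvec x i = subvec (\<Sum>s=1..CARD('n). block_unit s *v subvec x s :: real^('n \<times> 'd)) i" ..
qed

lemma subvec_mult_block_unit: "subvec (A *v (block_unit j *v u)) i = block A i j *v u"
proof -
  have "(\<Sum>q\<in>UNIV. A $ p $ q * (if fst q = idx j then u $ snd q else 0)) = (\<Sum>l\<in>UNIV. A $ p $ (idx j, l) * u $ l)" for p
  proof -
    have "(\<Sum>q\<in>UNIV. A $ p $ q * (if fst q = idx j then u $ snd q else 0)) =
        (\<Sum>m\<in>UNIV. \<Sum>l\<in>UNIV. A $ p $ (m, l) * (if m = idx j then u $ l else 0))"
      by (simp add: sum.cartesian_product case_prod_beta UNIV_Times_UNIV[symmetric] del: UNIV_Times_UNIV)
    also have "\<dots> = (\<Sum>m\<in>UNIV. if m = idx j then \<Sum>l\<in>UNIV. A $ p $ (m, l) * u $ l else 0)"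
      by (intro sum.cong) auto
    finally show ?thesis by simp
  qed
  then show ?thesis
    by (simp add: matrix_vector_mult_def[of A] block_unit_mult_nth subvec_def vec_eq_iff)
       (simp add: matrix_vector_mult_def block_def)
qed

lemma subvec_mult:
  fixes A :: "real^('n::{finite,linorder} \<times> 'd::finite)^('n \<times> 'd)"
  shows "subvec (A *v x) i = (\<Sum>s=1..CARD('n). block A i s *v subvec x s)"
proof -
  have "subvec (A *v (\<Sum>s\<in>S. block_unit s *v subvec x s)) i = (\<Sum>s\<in>S. block A i s *v subvec x s)" for S
    by (induction S rule: infinite_finite_induct)
      (simp_all add: subvec_linear matrix_vector_right_distrib subvec_mult_block_unit)
  from this[of "{1..CARD('n)}"] show ?thesis
    by (simp only: vec_eq_sum_block_unit[symmetric])
qed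

text \<open>This is the complementarity condition of \<open>XB\<close>: each block whose entry of
  \<open>z\<close> differs from 1 vanishes.\<close>

definition block_supp :: "real^'n::{finite,linorder} \<Rightarrow> real^('n \<times> 'd::finite) \<Rightarrow> bool" where
  "block_supp z x \<longleftrightarrow> (\<forall>i\<in>{1..CARD('n)}. (1 - z $ idx i) *\<^sub>R subvec x i = 0)"

lemma inner_eq_0_of_block_supp:
  fixes x y :: "real^('n::{finite,linorder} \<times> 'd::finite)"
  assumes "block_supp z x" and "\<And>i. i \<in> {1..CARD('n)} \<Longrightarrow> z $ idx i = 1 \<Longrightarrow> subvec y i = 0"
  shows "x \<bullet> y = 0"
proof -
  have "x $ q * y $ q = 0" for q
  proof -
    obtain i k where i: "i \<in> {1..CARD('n)}" "q = (idx i, k)" using ex_idx by (cases q) blast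
    then have "subvec x i = 0 \<or> subvec y i = 0"
      using assms(1) assms(2)[of i] by (cases "z $ idx i = 1") (auto simp: block_supp_def)
    then show ?thesis
      by (auto simp: subvec_def vec_eq_iff i)
  qed
  then show ?thesis
    unfolding inner_vec_def inner_real_def by (intro sum.neutral ballI)
qed

section \<open>Inverses and congruences of positive definite matrices\<close>

lemma invertible_matrix_inv:
  fixes A :: "real^'m^'m"
  assumes "invertible A"
  shows "A ** matrix_inv A = mat 1 \<and> matrix_inv A ** A = mat 1"
  using assms unfolding invertible_def matrix_inv_def by (rule someI_ex)

lemmas matrix_inv_right = invertible_matrix_inv[THEN conjunct1]
  and matrix_inv_left = invertible_matrix_inv[THEN conjunct2]

lemma pos_def_imp_invertible:
  assumes "pos_def A"
  shows "invertible A"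
proof -
  have "\<forall>x. A *v x = 0 \<longrightarrow> x = 0"
    using assms unfolding pos_def_def by (metis inner_zero_right less_irrefl)
  then show ?thesis
    by (metis invertible_left_inverse matrix_left_invertible_ker)
qed

lemma matrix_vector_inverse:
  fixes A :: "real^'m^'m"
  assumes "invertible A"
  shows "matrix_inv A *v (A *v x) = x" "A *v (matrix_inv A *v x) = x"
  using assms by (simp_all add: matrix_vector_mul_assoc matrix_inv_left matrix_inv_right)

lemma matrix_inv_transpose:
  fixes A :: "real^'m^'m"
  assumes "invertible A"
  shows "matrix_inv (transpose A) = transpose (matrix_inv A)"
proof -
  have "transpose (matrix_inv A) ** transpose A = mat 1"
    by (metis assms matrix_inv_right matrix_transpose_mul transpose_mat)
  moreover have "invertible (transpose A)"
    using assms by (rule transpose_invertible)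
  ultimately show ?thesis
    by (metis matrix_inv_right matrix_mul_assoc matrix_mul_lid matrix_mul_rid)
qed

lemma transpose_diff: "transpose (A - B) = transpose A - transpose B"
  by (simp add: transpose_def vec_eq_iff)

lemma pos_semidef_matrix_inv:
  assumes "pos_def A"
  shows "pos_semidef (matrix_inv A)"
proof -
  have inv: "invertible A" using assms by (rule pos_def_imp_invertible)
  have sym: "transpose A = A" using assms by (simp add: pos_def_def)
  have "transpose (matrix_inv A) = matrix_inv A"
  proof -
    have "transpose (matrix_inv A) ** A = mat 1"
      by (metis inv matrix_inv_right matrix_transpose_mul sym transpose_mat)
    then have "transpose (matrix_inv A) ** A ** matrix_inv A = matrix_inv A"
      by simp
    then show ?thesis
      by (simp add: matrix_mul_assoc[symmetric] matrix_inv_right inv)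
  qed
  moreover have "0 \<le> v \<bullet> (matrix_inv A *v v)" for v
  proof -
    let ?u = "matrix_inv A *v v"
    have "v \<bullet> ?u = (A *v ?u) \<bullet> ?u" using inv by (simp add: matrix_vector_inverse)
    also have "\<dots> \<ge> 0"
      using assms by (cases "?u = 0") (auto simp: pos_def_def inner_commute less_imp_le)
    finally show ?thesis .
  qed
  ultimately show ?thesis by (simp add: pos_semidef_def)
qed

lemma inner_transpose: "(transpose B *v v) \<bullet> y = v \<bullet> (B *v y)" for B :: "real^'k^'m"
  by (simp add: transpose_matrix_vector dot_lmul_matrix)

lemma pos_semidef_congruence:
  fixes B :: "real^'k^'m"
  assumes "pos_semidef M"
  shows "pos_semidef (B ** M ** transpose B)"
proof -
  have "transpose (B ** M ** transpose B) = B ** M ** transpose B"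
    using assms by (simp add: matrix_transpose_mul matrix_mul_assoc pos_semidef_def)
  moreover have "v \<bullet> ((B ** M ** transpose B) *v v) = (transpose B *v v) \<bullet> (M *v (transpose B *v v))" for v
    by (simp add: matrix_vector_mul_assoc[symmetric] inner_transpose)
  ultimately show ?thesis
    using assms by (simp add: pos_semidef_def)
qed

lemma pos_semidef_add:
  assumes "pos_semidef A" "pos_semidef B"
  shows "pos_semidef (A + B)"
proof -
  have "transpose (A + B) = transpose A + transpose B"
    by (simp add: transpose_def vec_eq_iff)
  then show ?thesis
    using assms by (simp add: pos_semidef_def matrix_vector_mult_add_rdistrib inner_add_right)
qed


section \<open>Inverses of principal block submatrices\<close>

locale block_factorized =
  fixes Q :: "real^('n::{finite,linorder} \<times> 'd::finite)^('n \<times> 'd)" and U V :: "nat \<Rightarrow> real^'d^'d"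
  assumes Q_pos: "pos_def Q" and Q_fact: "block_factorizable Q U V"
begin

lemma Q_sym: "transpose Q = Q"
  using Q_pos by (simp add: pos_def_def)

lemma block_upper: "1 \<le> i \<Longrightarrow> i \<le> j \<Longrightarrow> j \<le> CARD('n) \<Longrightarrow> block Q i j = U i ** transpose (V j)"
  using Q_fact by (simp add: block_factorizable_def)

lemma block_transpose: "transpose (block Q i j) = block Q j i"
proof -
  have "transpose Q $ p $ q = Q $ q $ p" for p q
    by (simp add: transpose_def)
  then have "Q $ p $ q = Q $ q $ p" for p q
    unfolding Q_sym .
  then show ?thesis
    unfolding block_def transpose_def vec_eq_iff vec_lambda_beta by blast
qed

lemma block_lower: "1 \<le> i \<Longrightarrow> i \<le> j \<Longrightarrow> j \<le> CARD('n) \<Longrightarrow> block Q j i = V j ** transpose (U i)"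
  unfolding block_transpose[of i j, symmetric] by (simp add: block_upper matrix_transpose_mul)

lemma block_unit_quad:
  "i \<in> {1..CARD('n)} \<Longrightarrow> (transpose (block_unit i) *v (Q *v (block_unit i *v u))) = block Q i i *v u"
  by (simp add: transpose_block_unit_mult subvec_mult_block_unit)

text \<open>\<open>D\<close> is the compression of \<open>Q\<close> by the injective matrix
  \<open>B\<close>. With \<open>B\<close> a block unit it is a diagonal block of \<open>Q\<close>,
  with \<open>B = gap\<close> a Schur complement.\<close>

lemma pos_def_compress:
  fixes B :: "real^'d^('n \<times> 'd)"
  assumes B: "\<And>u. transpose B *v (Q *v (B *v u)) = D *v u"
    and inj: "\<And>u. B *v u = 0 \<Longrightarrow> u = 0"
  shows "pos_def D"
proof -
  have "D = transpose B ** Q ** B"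
    using B by (simp add: matrix_eq matrix_vector_mul_assoc matrix_mul_assoc)
  then have "transpose D = D"
    by (simp add: matrix_transpose_mul matrix_mul_assoc Q_sym)
  moreover have "0 < u \<bullet> (D *v u)" if "u \<noteq> 0" for u
  proof -
    have "u \<bullet> (D *v u) = (B *v u) \<bullet> (Q *v (B *v u))"
      using inner_transpose[of "transpose B" u] by (simp add: B[symmetric])
    then show ?thesis
      using Q_pos inj that by (auto simp: pos_def_def)
  qed
  ultimately show ?thesis by (simp add: pos_def_def)
qed

lemma block_unit_mult_inj:
  "i \<in> {1..CARD('n)} \<Longrightarrow> (block_unit i *v u :: real^('n \<times> 'd)) = 0 \<Longrightarrow> u = 0"
  by (metis subvec_block_unit_mult subvec_zero)

lemma pos_def_diag:
  assumes "i \<in> {1..CARD('n)}"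
  shows "pos_def (U i ** transpose (V i))"
proof (rule pos_def_compress)
  fix u
  show "transpose (block_unit i :: real^'d^('n \<times> 'd)) *v (Q *v (block_unit i *v u)) =
      (U i ** transpose (V i)) *v u"
    using block_unit_quad[OF assms] assms by (simp add: block_upper)
qed (rule block_unit_mult_inj[OF assms])

text \<open>The determinant of the invertible diagonal block factors through that of
  \<open>U i\<close>.\<close>

lemma invertible_U: "i \<in> {1..CARD('n)} \<Longrightarrow> invertible (U i)"
  using pos_def_imp_invertible[OF pos_def_diag]
  by (simp add: invertible_det_nz det_mul)

text \<open>All block rows up to \<open>j\<close> see a vector supported from \<open>j\<close> on
  through one common vector, because their blocks there share the right factors
  \<open>transpose (V s)\<close>.\<close>

lemma subvec_Q_upper:
  assumes "1 \<le> i" "i \<le> j" "j \<le> CARD('n)" and x: "\<And>s. s \<in> {1..CARD('n)} \<Longrightarrow> s < j \<Longrightarrow> subvec x s = 0"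
  shows "subvec (Q *v x) i = U i *v (\<Sum>s=j..CARD('n). transpose (V s) *v subvec x s)"
proof -
  have "subvec (Q *v x) i = (\<Sum>s=j..CARD('n). block Q i s *v subvec x s)"
    unfolding subvec_mult using assms by (intro sum.mono_neutral_right) auto
  also have "\<dots> = (\<Sum>s=j..CARD('n). U i *v (transpose (V s) *v subvec x s))"
    using assms by (intro sum.cong) (auto simp: block_upper matrix_vector_mul_assoc)
  finally show ?thesis
    by (simp add: linear_sum[OF matrix_vector_mul_linear, unfolded o_def])
qed

section \<open>The matrix of an arc between two blocks\<close>

context
  fixes i j
  assumes ij: "1 \<le> i" "i < j" "j \<le> CARD('n)"
begin

text \<open>Block column \<open>i\<close> minus its projection, orthogonal with respect to
  \<open>Q\<close>, onto the vectors supported on blocks from \<open>j\<close> on. That projection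
  lies in block \<open>j\<close> alone.\<close>

definition "gap = (block_unit i - block_unit j ** (matrix_inv (transpose (U j)) ** transpose (U i)) :: real^'d^('n \<times> 'd))"

text \<open>The Schur complement of the diagonal block \<open>j\<close> in the principal submatrix
  of \<open>Q\<close> on blocks \<open>i\<close> and \<open>j\<close>; it is also the compression of
  \<open>Q\<close> by \<open>gap\<close>.\<close>

definition "schur = U i ** transpose (V i) - U i ** matrix_inv (U j) ** V j ** transpose (U i)"

definition "shift u = matrix_inv (transpose (U j)) *v (transpose (U i) *v u)"

lemma gap_mult: "gap *v u = block_unit i *v u - block_unit j *v shift u"
  by (simp add: gap_def shift_def matrix_vector_mult_diff_rdistrib matrix_vector_mul_assoc matrix_mul_assoc)

lemma transpose_gap_mult: "transpose gap *v x = subvec x i - U i *v (matrix_inv (U j) *v subvec x j)"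
proof -
  have inv: "invertible (U j)" using ij invertible_U by simp
  have *: "transpose gap = transpose (block_unit i) - U i ** (matrix_inv (U j) ** transpose (block_unit j))"
    by (simp add: gap_def transpose_diff matrix_transpose_mul matrix_mul_assoc matrix_inv_transpose[OF inv])
  show ?thesis
    by (simp add: * matrix_vector_mult_diff_rdistrib matrix_vector_mul_assoc[symmetric] transpose_block_unit_mult)
qed

text \<open>Blocks \<open>i\<close> and \<open>j\<close> of \<open>Q *v x\<close> are
  \<open>U i\<close> and \<open>U j\<close> times the same vector, so their contributions
  cancel.\<close>

lemma gap_orthogonal:
  assumes "\<And>s. s \<in> {1..CARD('n)} \<Longrightarrow> s < j \<Longrightarrow> subvec x s = 0"
  shows "transpose gap *v (Q *v x) = 0"
proof -
  define h where "h = (\<Sum>s=j..CARD('n). transpose (V s) *v subvec x s)"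
  have "subvec (Q *v x) i = U i *v h" "subvec (Q *v x) j = U j *v h"
    unfolding h_def using ij assms by (auto intro!: subvec_Q_upper)
  moreover have "invertible (U j)" using ij invertible_U by simp
  ultimately show ?thesis
    by (simp add: transpose_gap_mult matrix_vector_inverse)
qed

lemma transpose_gap_Q: "transpose gap *v (Q *v (block_unit i *v u)) = schur *v u"
  using ij by (simp add: transpose_gap_mult subvec_mult_block_unit block_upper block_lower schur_def
      matrix_vector_mult_diff_rdistrib matrix_vector_mul_assoc[symmetric])

lemma transpose_gap_Q_gap: "transpose gap *v (Q *v (gap *v u)) = schur *v u"
proof -
  \<comment> \<open>The second summand of \<open>gap *v u\<close> lies in block \<open>j\<close>, to
    which \<open>gap\<close> is orthogonal, so only block \<open>i\<close> counts.\<close>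
  have "transpose gap *v (Q *v (block_unit j *v shift u)) = 0"
    using ij by (intro gap_orthogonal) (simp add: subvec_block_unit_mult)
  then show ?thesis
    by (simp add: gap_mult matrix_vector_mult_diff_distrib transpose_gap_Q)
qed

lemma pos_def_schur: "pos_def schur"
proof (rule pos_def_compress)
  fix u assume "gap *v u = 0"
  then have "subvec (gap *v u) i = 0" by (simp add: subvec_zero)
  then show "u = 0"
    using ij by (simp add: gap_mult subvec_linear subvec_block_unit_mult)
qed (rule transpose_gap_Q_gap)

abbreviation "L \<equiv> (Lam U V i j :: real^('n \<times> 'd)^('n \<times> 'd))"

text \<open>In this form \<open>L ** Q\<close> is the projection onto the range of
  \<open>gap\<close>, orthogonal with respect to \<open>Q\<close>: it kills vectors supported from
  \<open>j\<close> on and sends block column \<open>i\<close> to \<open>gap\<close>.\<close>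

lemma Lam_eq_gap: "L = gap ** matrix_inv schur ** transpose gap"
  using ij by (simp add: Lam_def gap_def schur_def Let_def)

lemma Lam_Q_later:
  assumes "\<And>s. s \<in> {1..CARD('n)} \<Longrightarrow> s < j \<Longrightarrow> subvec x s = 0"
  shows "L *v (Q *v x) = 0"
  using gap_orthogonal[OF assms] by (simp add: Lam_eq_gap matrix_vector_mul_assoc[symmetric])

lemma Lam_Q_block_unit: "L *v (Q *v (block_unit i *v u)) = block_unit i *v u - block_unit j *v shift u"
  by (simp add: Lam_eq_gap transpose_gap_Q matrix_vector_mul_assoc[symmetric] gap_mult[symmetric]
      matrix_vector_inverse pos_def_imp_invertible pos_def_schur)

text \<open>Both sides equal \<open>V s\<close> applied to \<open>transpose (U i) *v u\<close>,
  since \<open>shift\<close> undoes the factor \<open>transpose (U j)\<close>.\<close>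

lemma Q_block_unit_later:
  assumes "s \<in> {j..CARD('n)}"
  shows "subvec (Q *v (block_unit i *v u)) s = subvec (Q *v (block_unit j *v shift u)) s"
proof -
  have "invertible (transpose (U j))" using ij by (intro transpose_invertible invertible_U) simp
  then show ?thesis
    using ij assms by (simp add: subvec_mult_block_unit block_lower shift_def matrix_vector_inverse
      matrix_vector_mul_assoc[symmetric])
qed

lemma pos_semidef_Lam_le: "pos_semidef (L)"
  unfolding Lam_eq_gap by (intro pos_semidef_congruence pos_semidef_matrix_inv pos_def_schur)

lemma subvec_Lam: "s \<in> {1..CARD('n)} \<Longrightarrow> s \<noteq> i \<Longrightarrow> s \<noteq> j \<Longrightarrow> subvec (L *v y) s = 0"
  using ij by (simp add: Lam_eq_gap matrix_vector_mul_assoc[symmetric] gap_mult subvec_linear subvec_block_unit_mult)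

end

lemma Lam_last:
  assumes "i \<in> {1..CARD('n)}"
  shows "(Lam U V i (CARD('n) + 1) :: real^('n \<times> 'd)^('n \<times> 'd)) =
    block_unit i ** matrix_inv (U i ** transpose (V i)) ** transpose (block_unit i)"
  by (simp add: Lam_def)

lemma pos_semidef_Lam:
  assumes "1 \<le> i" "i < j" "j \<le> CARD('n) + 1"
  shows "pos_semidef (Lam U V i j :: real^('n \<times> 'd)^('n \<times> 'd))"
proof (cases "j \<le> CARD('n)")
  case True
  then show ?thesis using pos_semidef_Lam_le assms by blast
next
  case False
  then have j: "j = CARD('n) + 1" using assms by simp
  have i: "i \<in> {1..CARD('n)}" using assms j by simp
  show ?thesis
    unfolding j Lam_last[OF i] by (intro pos_semidef_congruence pos_semidef_matrix_inv pos_def_diag i)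
qed

text \<open>An arc carries its matrix and the indicator of its tail, so a path sums both. Node 0 is
  not a block, hence arcs leaving it contribute nothing.\<close>

definition arc_value :: "nat \<Rightarrow> nat \<Rightarrow> (real^('n \<times> 'd)^('n \<times> 'd)) \<times> (real^'n::{finite,linorder})" where
  "arc_value i j = (if i = 0 then 0 else (Lam U V i j, axis (idx i) 1))"

text \<open>\<open>W\<close> is the inverse of the principal submatrix of \<open>Q\<close> on the blocks \<open>S = {s. z $ idx s = 1}\<close>,
  extended by zero: it maps into the vectors supported on \<open>S\<close> and inverts \<open>Q\<close> there.\<close>

definition sub_inverse :: "real^('n \<times> 'd)^('n \<times> 'd) \<Rightarrow> real^'n::{finite,linorder} \<Rightarrow> bool" where
  "sub_inverse W z \<longleftrightarrow> pos_semidef W \<and> (\<forall>y. block_supp z (W *v y)) \<and>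
    (\<forall>x. block_supp z x \<longrightarrow> W *v (Q *v x) = x)"

text \<open>\<open>W\<close> is symmetric with range supported on the support, so it ignores all
  other blocks of its argument.\<close>

lemma sub_inverse_cong:
  assumes W: "sub_inverse W z" and "\<And>s. s \<in> {1..CARD('n)} \<Longrightarrow> z $ idx s = 1 \<Longrightarrow> subvec a s = subvec b s"
  shows "W *v a = W *v b"
proof -
  have "(W *v (W *v (a - b))) \<bullet> (a - b) = 0"
    using assms by (intro inner_eq_0_of_block_supp[of z]) (auto simp: sub_inverse_def subvec_diff)
  moreover have "(W *v (W *v (a - b))) \<bullet> (a - b) = (W *v (a - b)) \<bullet> (W *v (a - b))"
    using W by (intro symmetric_matrix_inner) (simp add: sub_inverse_def pos_semidef_def)
  ultimately have "W *v (a - b) = 0" by simp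
  then show ?thesis by (simp add: matrix_vector_mult_diff_distrib)
qed

text \<open>The support added to is empty, so \<open>W\<close> acts as zero and the new inverse is
  that of one diagonal block.\<close>

lemma sub_inverse_step_last:
  assumes W: "sub_inverse W z" and z: "\<And>s. s \<in> {1..CARD('n)} \<Longrightarrow> z $ idx s = 0"
    and i: "i \<in> {1..CARD('n)}"
    and z': "\<And>s. s \<in> {1..CARD('n)} \<Longrightarrow> z' $ idx s = (if s = i then 1 else z $ idx s)"
  shows "sub_inverse (Lam U V i (CARD('n) + 1) + W) z'"
proof -
  let ?L = "Lam U V i (CARD('n) + 1) :: real^('n \<times> 'd)^('n \<times> 'd)"
  have W0: "W *v y = 0" for y
    using W z by (intro vec_eq_subvecI) (simp add: sub_inverse_def block_supp_def subvec_zero)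
  have L: "?L *v y = block_unit i *v (matrix_inv (U i ** transpose (V i)) *v subvec y i)" for y
    unfolding Lam_last[OF i] by (simp add: matrix_vector_mul_assoc[symmetric] transpose_block_unit_mult)
  have "?L *v (Q *v x) = x" if x: "block_supp z' x" for x
  proof -
    have "subvec x s = subvec (block_unit i *v subvec x i :: real^('n \<times> 'd)) s" if "s \<in> {1..CARD('n)}" for s
    proof -
      have "(1 - z' $ idx s) *\<^sub>R subvec x s = 0" using x that by (simp add: block_supp_def)
      then show ?thesis
        using z[OF that] z'[OF that] that i by (auto simp: subvec_block_unit_mult)
    qed
    then have xe: "x = block_unit i *v subvec x i"
      by (rule vec_eq_subvecI)
    have "subvec (Q *v x) i = (U i ** transpose (V i)) *v subvec x i"
      using i by (subst xe) (simp add: subvec_mult_block_unit block_upper)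
    then have "?L *v (Q *v x) = block_unit i *v subvec x i"
      unfolding L using pos_def_diag[OF i] by (simp add: pos_def_imp_invertible matrix_vector_inverse)
    then show ?thesis using xe by simp
  qed
  moreover have "block_supp z' (?L *v y)" for y
    unfolding block_supp_def
  proof
    fix s assume s: "s \<in> {1..CARD('n)}"
    show "(1 - z' $ idx s) *\<^sub>R subvec (?L *v y) s = 0"
      unfolding L z'[OF s] subvec_block_unit_mult[OF i s] by simp
  qed
  moreover have "pos_semidef (?L + W)"
    using i W by (intro pos_semidef_add pos_semidef_Lam) (auto simp: sub_inverse_def)
  ultimately show ?thesis
    by (simp add: sub_inverse_def matrix_vector_mult_add_rdistrib W0)
qed

text \<open>The block column of \<open>Q\<close> at \<open>i\<close> coincides from block row \<open>j\<close> on with \<open>Q\<close> times a block column at \<open>j\<close>;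
  this is what makes the inverse of a principal block submatrix a sum over consecutive indices.\<close>

lemma sub_inverse_step:
  assumes W: "sub_inverse W z" and ij: "1 \<le> i" "i < j" "j \<le> CARD('n)"
    and z: "\<And>s. s \<in> {1..CARD('n)} \<Longrightarrow> s < j \<Longrightarrow> z $ idx s = 0" "z $ idx j = 1"
    and z': "\<And>s. s \<in> {1..CARD('n)} \<Longrightarrow> z' $ idx s = (if s = i then 1 else z $ idx s)"
  shows "sub_inverse (Lam U V i j + W) z'"
proof -
  let ?L = "Lam U V i j :: real^('n \<times> 'd)^('n \<times> 'd)"
  have "(?L + W) *v (Q *v x) = x" if x: "block_supp z' x" for x
  proof -
    \<comment> \<open>Split \<open>x\<close> into its block \<open>i\<close>, which is
      \<open>?e\<close>, and the rest \<open>y\<close>, which is supported on the old support and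
      hence from \<open>j\<close> on.\<close>
    define u where "u = subvec x i"
    let ?e = "block_unit i *v u :: real^('n \<times> 'd)"
    let ?f = "block_unit j *v shift i j u :: real^('n \<times> 'd)"
    define y where "y = x - ?e"
    have y: "block_supp z y"
      using x z' ij by (auto simp: block_supp_def y_def u_def subvec_diff subvec_block_unit_mult split: if_splits)
    then have "subvec y s = 0" if "s \<in> {1..CARD('n)}" "s < j" for s
      using z(1) that by (force simp: block_supp_def)
    then have Ly: "?L *v (Q *v y) = 0"
      using Lam_Q_later[OF ij] by blast
    have "block_supp z ?f"
      using z ij by (auto simp: block_supp_def subvec_block_unit_mult)
    then have "W *v (Q *v ?f) = ?f"
      using W by (simp add: sub_inverse_def)
    \<comment> \<open>\<open>W\<close> sees only blocks from \<open>j\<close> on, where the two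
      columns agree. It thus returns \<open>?f\<close>, and \<open>?L\<close> supplies the missing
      \<open>?e - ?f\<close>.\<close>
    moreover have "W *v (Q *v ?e) = W *v (Q *v ?f)"
    proof (rule sub_inverse_cong[OF W])
      fix s assume "s \<in> {1..CARD('n)}" "z $ idx s = 1"
      then have "s \<in> {j..CARD('n)}"
        using z(1)[of s] by (cases "s < j") auto
      then show "subvec (Q *v ?e) s = subvec (Q *v ?f) s"
        by (rule Q_block_unit_later[OF ij])
    qed
    moreover have "W *v (Q *v y) = y"
      using W y by (simp add: sub_inverse_def)
    moreover have "x = ?e + y" by (simp add: y_def)
    ultimately show ?thesis
      using Ly Lam_Q_block_unit[OF ij, of u]
      by (simp add: matrix_vector_mult_add_rdistrib matrix_vector_right_distrib)
  qed
  moreover have "block_supp z' ((?L + W) *v y)" for y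
    unfolding block_supp_def
  proof
    fix s assume s: "s \<in> {1..CARD('n)}"
    \<comment> \<open>\<open>?L\<close> reaches only blocks \<open>i\<close> and \<open>j\<close>,
      and both belong to the new support.\<close>
    have "block_supp z (W *v y)" using W by (simp add: sub_inverse_def)
    then show "(1 - z' $ idx s) *\<^sub>R subvec ((?L + W) *v y) s = 0"
      using s z(2) z'[OF s] subvec_Lam[OF ij s, of y]
      by (cases "s = i \<or> s = j") (auto simp: block_supp_def matrix_vector_mult_add_rdistrib subvec_add)
  qed
  moreover have "pos_semidef (?L + W)"
    using ij W by (intro pos_semidef_add pos_semidef_Lam) (auto simp: sub_inverse_def)
  ultimately show ?thesis
    by (simp add: sub_inverse_def)
qed

text \<open>The induction also records that the support starts exactly at \<open>i\<close>, as the
  step lemmas require; the end node \<open>CARD('n) + 1\<close> stands for the empty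
  support.\<close>

lemma path_value_sub_inverse_from:
  assumes "path_value arc_value (CARD('n) + 1) i v" and "1 \<le> i"
  shows "sub_inverse (fst v) (snd v) \<and>
    (\<forall>s\<in>{1..CARD('n)}. snd v $ idx s \<in> {0, 1} \<and> (s < i \<longrightarrow> snd v $ idx s = 0)) \<and>
    (i \<le> CARD('n) \<longrightarrow> snd v $ idx i = 1)"
  using assms
proof (induction rule: path_value.induct)
  case path_value_end
  have "x = 0" if "block_supp 0 x" for x :: "real^('n \<times> 'd)"
    using that by (intro vec_eq_subvecI) (auto simp: block_supp_def subvec_zero)
  then show ?case
    by (auto simp: sub_inverse_def pos_semidef_def block_supp_def transpose_def vec_eq_iff subvec_zero)
next
  case (path_value_step i j v)
  have j: "j \<le> CARD('n) + 1" using path_value_step.hyps path_value_le by blast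
  have i: "i \<in> {1..CARD('n)}" using j path_value_step by auto
  have IH: "sub_inverse (fst v) (snd v)"
    "\<And>s. s \<in> {1..CARD('n)} \<Longrightarrow> snd v $ idx s \<in> {0, 1}"
    "\<And>s. s \<in> {1..CARD('n)} \<Longrightarrow> s < j \<Longrightarrow> snd v $ idx s = 0"
    "j \<le> CARD('n) \<Longrightarrow> snd v $ idx j = 1"
    using path_value_step by auto
  have fst: "fst (arc_value i j + v) = Lam U V i j + fst v"
    and snd: "snd (arc_value i j + v) = axis (idx i) 1 + snd v"
    using i by (simp_all add: arc_value_def)
  have z': "(axis (idx i) 1 + snd v) $ idx s = (if s = i then 1 else snd v $ idx s)"
    if "s \<in> {1..CARD('n)}" for s
    using that i path_value_step.hyps(1) IH(3)[of i] by (auto simp: axis_def idx_eq_iff)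
  have "sub_inverse (Lam U V i j + fst v) (axis (idx i) 1 + snd v)"
  proof (cases "j \<le> CARD('n)")
    case True
    then show ?thesis
      using i path_value_step.hyps(1) IH z' by (intro sub_inverse_step[where z = "snd v"]) auto
  next
    case False
    then have jn: "j = CARD('n) + 1" using j by simp
    show ?thesis
      unfolding jn using i IH z' jn by (intro sub_inverse_step_last[where z = "snd v"]) auto
  qed
  then show ?case
    unfolding fst snd using z' IH i path_value_step.hyps(1)
    by (auto simp del: vector_add_component)
qed

lemma path_value_sub_inverse:
  assumes "path_value arc_value (CARD('n) + 1) 0 v"
  shows "sub_inverse (fst v) (snd v) \<and> (\<forall>s\<in>{1..CARD('n)}. snd v $ idx s \<in> {0, 1})"
  using assms
proof (cases rule: path_value.cases)
  case (path_value_step j v')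
  then have "v = v'" "1 \<le> j" by (simp_all add: arc_value_def)
  then show ?thesis
    using path_value_sub_inverse_from path_value_step by blast
qed simp

text \<open>The path visits the support in increasing order. It is built by downward induction on a
  lower bound \<open>m\<close> for the support, and the arc from 0 is prepended last.\<close>

lemma ex_path_value_indicator:
  assumes z01: "\<And>s. s \<in> {1..CARD('n)} \<Longrightarrow> z $ idx s \<in> {0, 1}"
  shows "\<exists>W. path_value arc_value (CARD('n) + 1) 0 (W, z)"
proof -
  have "\<exists>j\<ge>m. \<exists>W. path_value arc_value (CARD('n) + 1) j (W, z)"
    if "m \<le> CARD('n) + 1" "\<And>s. s \<in> {1..CARD('n)} \<Longrightarrow> z $ idx s \<in> {0, 1}"
      "\<And>s. s \<in> {1..CARD('n)} \<Longrightarrow> s < m \<Longrightarrow> z $ idx s = 0" "1 \<le> m" for m and z :: "real^'n::{finite,linorder}"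
    using that
  proof (induction m arbitrary: z rule: inc_induct)
    case base
    have "z $ p = 0" for p
      using ex_idx[of p] base by auto
    then have "(0, z) = (0 :: (real^('n \<times> 'd)^('n \<times> 'd)) \<times> (real^'n::{finite,linorder}))"
      by (simp add: vec_eq_iff zero_prod_def)
    then show ?case
      using path_value_end by (metis order_refl)
  next
    case (step m)
    have m: "m \<in> {1..CARD('n)}" using step by simp
    show ?case
    proof (cases "z $ idx m = 0")
      case True
      then have "\<exists>j\<ge>Suc m. \<exists>W. path_value arc_value (CARD('n) + 1) j (W, z)"
        using step by (intro step.IH) (auto simp: less_Suc_eq)
      then show ?thesis using Suc_leD by blast
    next
      case False
      then have zm: "z $ idx m = 1" using step.prems(1)[OF m] by simp
      \<comment> \<open>Removing \<open>m\<close> leaves a support bounded below by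
        \<open>Suc m\<close>; the arc from \<open>m\<close> to its first node restores it.\<close>
      let ?z = "z - axis (idx m) 1"
      have z': "?z $ idx s = (if s = m then 0 else z $ idx s)" if "s \<in> {1..CARD('n)}" for s
        using that m zm by (auto simp: axis_def idx_eq_iff)
      have "\<exists>j\<ge>Suc m. \<exists>W. path_value arc_value (CARD('n) + 1) j (W, ?z)"
        using step.prems by (intro step.IH) (auto simp: z' less_Suc_eq simp del: vector_minus_component)
      then obtain j W where j: "Suc m \<le> j" "path_value arc_value (CARD('n) + 1) j (W, ?z)" by blast
      then have "path_value arc_value (CARD('n) + 1) m (arc_value m j + (W, ?z))"
        by (intro path_value_step) auto
      moreover have "arc_value m j + (W, ?z) = (Lam U V m j + W, z)"
        using m by (simp add: arc_value_def)
      ultimately show ?thesis by (metis order_refl)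
    qed
  qed
  from this[of 1 z] obtain j W where j: "1 \<le> j" "path_value arc_value (CARD('n) + 1) j (W, z)"
    using z01 by auto
  then have "path_value arc_value (CARD('n) + 1) 0 (arc_value 0 j + (W, z))"
    by (intro path_value_step) auto
  then show ?thesis
    by (auto simp: arc_value_def)
qed

subsection \<open>The closed convex hull\<close>

text \<open>The polytope spanned by the pairs of an extended inverse and the indicator of its
  support.\<close>

abbreviation "inverse_hull \<equiv> convex hull {v. path_value arc_value (CARD('n) + 1) 0 v}"

text \<open>Take \<open>y = Q *v x\<close>: the extended inverse \<open>W\<close> for the support
  \<open>z\<close> gives \<open>W *v y = x\<close>, at cost
  \<open>x \<bullet> (Q *v x)\<close>.\<close>

lemma XB_subset: "XB Q \<subseteq> {(x, z, t). \<exists>W. (W, z) \<in> inverse_hull \<and> pos_semidef (bordered W x t)}"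
proof clarify
  fix x z t assume "(x, z, t) \<in> XB Q"
  then have z: "\<And>s. s \<in> {1..CARD('n)} \<Longrightarrow> z $ idx s \<in> {0, 1}" and t: "x \<bullet> (Q *v x) \<le> t" and x: "block_supp z x"
    by (auto simp: XB_def block_supp_def)
  obtain W where W: "path_value arc_value (CARD('n) + 1) 0 (W, z)"
    using ex_path_value_indicator[of z] z by blast
  then have W': "pos_semidef W" "W *v (Q *v x) = x"
    using path_value_sub_inverse[OF W] x by (auto simp: sub_inverse_def)
  then have "pos_semidef (bordered W (W *v (Q *v x)) t)"
    using t by (intro pos_semidef_bordered_mult) (simp_all add: inner_commute)
  then show "\<exists>W. (W, z) \<in> inverse_hull \<and> pos_semidef (bordered W x t)"
    using W W'(2) by (auto intro: hull_inc)
qed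

text \<open>Membership in the range of \<open>W = (\<Sum>S. c S *\<^sub>R Q\<^sub>S\<^sup>-\<^sup>1)\<close>, say \<open>x = W *v y\<close>, splits \<open>x\<close> into the
  points \<open>Q\<^sub>S\<^sup>-\<^sup>1 *v y\<close>, whose costs \<open>y \<bullet> (Q\<^sub>S\<^sup>-\<^sup>1 *v y)\<close> average to \<open>y \<bullet> (W *v y)\<close>.\<close>

lemma subset_hull_XB:
  "{(x, z, t). \<exists>W. (W, z) \<in> inverse_hull \<and> pos_semidef (bordered W x t)} \<subseteq> convex hull (XB Q)"
proof clarify
  fix x z t W
  assume W: "(W, z) \<in> inverse_hull" and "pos_semidef (bordered W x t)"
  then obtain y where y: "x = W *v y" "y \<bullet> (W *v y) \<le> t"
    by (elim pos_semidef_borderedE)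
  \<comment> \<open>The slack in \<open>t\<close> is given in full to every summand. The weights sum
    to 1, so the average is again \<open>t\<close>.\<close>
  define r where "r = t - y \<bullet> (W *v y)"
  have r: "0 \<le> r" using y by (simp add: r_def)
  define f where "f v = (fst v *v y, snd v, y \<bullet> (fst v *v y) + r)"
    for v :: "(real^('n \<times> 'd)^('n \<times> 'd)) \<times> (real^'n::{finite,linorder})"
  \<comment> \<open>\<open>f\<close> is affine, so it is enough that it maps path values into
    \<open>XB Q\<close>.\<close>
  have "inverse_hull \<subseteq> {v. f v \<in> convex hull (XB Q)}"
  proof (rule hull_minimal)
    show "{v. path_value arc_value (CARD('n) + 1) 0 v} \<subseteq> {v. f v \<in> convex hull (XB Q)}"
    proof clarify
      fix A w assume "path_value arc_value (CARD('n) + 1) 0 (A, w)"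
      from path_value_sub_inverse[OF this] have A: "sub_inverse A w" "\<forall>s\<in>{1..CARD('n)}. w $ idx s \<in> {0, 1}"
        by simp_all
      have supp: "block_supp w (A *v y)" using A by (simp add: sub_inverse_def)
      then have "A *v (Q *v (A *v y)) = A *v y" using A by (simp add: sub_inverse_def)
      moreover have "(A *v y) \<bullet> (Q *v (A *v y)) = y \<bullet> (A *v (Q *v (A *v y)))"
        using A by (intro symmetric_matrix_inner) (simp add: sub_inverse_def pos_semidef_def)
      moreover have "0 \<le> y \<bullet> (A *v y)"
        using A by (simp add: sub_inverse_def pos_semidef_def)
      ultimately have "f (A, w) \<in> XB Q"
        using A(2) supp r by (simp add: f_def XB_def block_supp_def)
      then show "f (A, w) \<in> convex hull (XB Q)" by (rule hull_inc)
    qed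
    show "convex {v. f v \<in> convex hull (XB Q)}"
    proof (rule convexI)
      fix u v and c d :: real
      assume cd: "0 \<le> c" "0 \<le> d" "c + d = 1"
        and uv: "u \<in> {v. f v \<in> convex hull (XB Q)}" "v \<in> {v. f v \<in> convex hull (XB Q)}"
      have "f (c *\<^sub>R u + d *\<^sub>R v) = c *\<^sub>R f u + d *\<^sub>R f v"
      proof -
        have "r = c * r + d * r" using cd by (simp add: distrib_right[symmetric])
        then show ?thesis
          by (simp add: f_def matrix_vector_mult_add_rdistrib scaleR_matrix_vector_assoc[symmetric]
              inner_add_right algebra_simps)
      qed
      also have "\<dots> \<in> convex hull (XB Q)"
        using cd uv convexD[OF convex_convex_hull] by simp
      finally show "c *\<^sub>R u + d *\<^sub>R v \<in> {v. f v \<in> convex hull (XB Q)}" by simp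
    qed
  qed
  then have "f (W, z) \<in> convex hull (XB Q)" using W by blast
  then show "(x, z, t) \<in> convex hull (XB Q)"
    by (simp add: f_def r_def y(1))
qed

text \<open>The right-hand side is convex, contains \<open>XB Q\<close>, and is closed as the
  projection of a closed relation along a compact polytope.\<close>

lemma closure_hull_XB:
  "closure (convex hull (XB Q)) = {(x, z, t). \<exists>W. (W, z) \<in> inverse_hull \<and> pos_semidef (bordered W x t)}"
    (is "_ = ?R")
proof
  have "compact inverse_hull"
    by (intro finite_imp_compact_convex_hull finite_path_values)
  from closed_compact_projection[OF this closed_pos_semidef_bordered] have "closed ?R"
    by (rule back_subst[of closed]) (auto simp: case_prod_beta)
  moreover have "convex hull (XB Q) \<subseteq> ?R"
    by (intro hull_minimal XB_subset convex_pos_semidef_bordered convex_convex_hull)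
  ultimately show "closure (convex hull (XB Q)) \<subseteq> ?R"
    by (intro closure_minimal)
  show "?R \<subseteq> closure (convex hull (XB Q))"
    using subset_hull_XB closure_subset by (rule order_trans)
qed

section \<open>The polytope written as a linear system in the flow\<close>

lemma flow_value_arc:
  "flow_value arc_value (CARD('n) + 1) w =
    (\<Sum>i=1..CARD('n). \<Sum>j=i+1..CARD('n)+1. w i j *\<^sub>R Lam U V i j,
     \<Sum>i=1..CARD('n). (\<Sum>j=i+1..CARD('n)+1. w i j) *\<^sub>R axis (idx i) 1)"
proof -
  have "{..<CARD('n) + 1} = insert 0 {1..CARD('n)}" by auto
  then have "flow_value arc_value (CARD('n) + 1) w =
      (\<Sum>i=1..CARD('n). \<Sum>j=i+1..CARD('n)+1. w i j *\<^sub>R arc_value i j)"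
    by (simp add: flow_value_def arc_value_def)
  also have "\<dots> = (\<Sum>i=1..CARD('n). \<Sum>j=i+1..CARD('n)+1. w i j *\<^sub>R (Lam U V i j, axis (idx i) 1))"
    by (intro sum.cong) (auto simp: arc_value_def)
  finally show ?thesis
    by (simp add: prod_eq_iff fst_sum snd_sum scaleR_sum_left del: sum.cl_ivl_Suc)
qed

text \<open>Summing tail indicators yields \<open>z\<close> as the outflow of each block node;
  conservation at the nodes strictly between 0 and \<open>CARD('n) + 1\<close> turns it into the
  inflow.\<close>

lemma inverse_hull_iff:
  "(W, z) \<in> inverse_hull \<longleftrightarrow>
    (\<exists>w. unit_flow (CARD('n) + 1) 0 w \<and>
      W = (\<Sum>i=1..CARD('n). \<Sum>j=i+1..CARD('n)+1. w i j *\<^sub>R Lam U V i j) \<and>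
      (\<forall>l\<in>{1..CARD('n)}. z $ idx l = (\<Sum>i<l. w i l)))"
proof -
  have "z = (\<Sum>i=1..CARD('n). (\<Sum>j=i+1..CARD('n)+1. w i j) *\<^sub>R axis (idx i) 1) \<longleftrightarrow>
      (\<forall>l\<in>{1..CARD('n)}. z $ idx l = (\<Sum>i<l. w i l))" if w: "unit_flow (CARD('n) + 1) 0 w" for w
  proof -
    let ?z = "(\<Sum>i=1..CARD('n). (\<Sum>j=i+1..CARD('n)+1. w i j) *\<^sub>R axis (idx i) 1) :: real^'n::{finite,linorder}"
    have out: "?z $ idx l = (\<Sum>i<l. w i l)" if l: "l \<in> {1..CARD('n)}" for l
    proof -
      have "?z $ idx l = (\<Sum>i=1..CARD('n). if i = l then \<Sum>j=i+1..CARD('n)+1. w i j else 0)"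
        using l unfolding sum_component by (intro sum.cong) (auto simp: axis_def idx_eq_iff)
      also have "\<dots> = (\<Sum>j=l+1..CARD('n)+1. w l j)" using l by simp
      also have "\<dots> = (\<Sum>i<l. w i l)"
      proof -
        have "(\<Sum>i<l. w i l) - (\<Sum>j=l+1..CARD('n)+1. w l j) = of_bool (l = CARD('n) + 1) - of_bool (l = 0)"
          by (rule bspec[OF w[unfolded unit_flow_def, THEN conjunct2]]) (use l in simp)
        also have "\<dots> = 0" using l by simp
        finally show ?thesis by (simp only: right_minus_eq)
      qed
      finally show ?thesis .
    qed
    show ?thesis
    proof
      assume "\<forall>l\<in>{1..CARD('n)}. z $ idx l = (\<Sum>i<l. w i l)"
      then have eq: "z $ idx l = ?z $ idx l" if "l \<in> {1..CARD('n)}" for l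
        unfolding out[OF that] using that by (rule bspec)
      show "z = ?z"
        unfolding vec_eq_iff
      proof
        fix p :: 'n
        obtain l where "l \<in> {1..CARD('n)}" "p = idx l" using ex_idx by blast
        then show "z $ p = ?z $ p" using eq[of l] by (simp only:)
      qed
    next
      assume "z = ?z"
      then show "\<forall>l\<in>{1..CARD('n)}. z $ idx l = (\<Sum>i<l. w i l)"
        by (intro ballI) (metis out)
    qed
  qed
  moreover have "(W, z) \<in> inverse_hull \<longleftrightarrow> (\<exists>w. (W, z) = flow_value arc_value (CARD('n) + 1) w \<and> unit_flow (CARD('n) + 1) 0 w)"
    unfolding unit_flow_values[OF le0, symmetric] by (rule mem_Collect_eq)
  ultimately show ?thesis
    unfolding flow_value_arc prod.inject by blast
qed

end

theorem theorem8:
  fixes Q :: "real^('n::{finite,linorder} \<times> 'd::finite)^('n \<times> 'd)"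
    and U V :: "nat \<Rightarrow> real^'d^'d"
  assumes "pos_def Q"
    and "block_factorizable Q U V"
  shows "closure (convex hull (XB Q)) =
    {(x, z, \<tau>).
      \<exists>(W :: real^('n \<times> 'd)^('n \<times> 'd)) (w :: nat \<Rightarrow> nat \<Rightarrow> real).
        (\<forall>i j. i < j \<and> j \<le> CARD('n) + 1 \<longrightarrow> 0 \<le> w i j) \<and>
        pos_semidef (bordered W x \<tau>) \<and>
        W = (\<Sum>i=1..CARD('n). \<Sum>j=i+1..CARD('n)+1. w i j *\<^sub>R Lam U V i j) \<and>
        (\<forall>l\<in>{1..CARD('n)}. z $ idx l = (\<Sum>i<l. w i l)) \<and>
        (\<forall>l\<in>{0..CARD('n)+1}.
          (\<Sum>i<l. w i l) - (\<Sum>j=l+1..CARD('n)+1. w l j) =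
            (if l = 0 then -1 else if l = CARD('n) + 1 then 1 else 0))}"
proof -
  interpret block_factorized Q U V
    using assms by unfold_locales
  \<comment> \<open>The two right-hand sides agree because source 0 and sink
    \<open>CARD('n) + 1\<close> are distinct.\<close>
  have balance: "(\<forall>l\<in>{0..CARD('n)+1}. a l = (if l = 0 then -1 else if l = CARD('n) + 1 then 1 else 0)) \<longleftrightarrow>
      (\<forall>l\<in>{0..CARD('n)+1}. a l = of_bool (l = CARD('n) + 1) - of_bool (l = 0))" for a :: "nat \<Rightarrow> real"
    by (intro ball_cong) auto
  have "(\<exists>W. (W, z) \<in> inverse_hull \<and> pos_semidef (bordered W x \<tau>)) \<longleftrightarrow>
      (\<exists>(W :: real^('n \<times> 'd)^('n \<times> 'd)) (w :: nat \<Rightarrow> nat \<Rightarrow> real).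
        (\<forall>i j. i < j \<and> j \<le> CARD('n) + 1 \<longrightarrow> 0 \<le> w i j) \<and>
        pos_semidef (bordered W x \<tau>) \<and>
        W = (\<Sum>i=1..CARD('n). \<Sum>j=i+1..CARD('n)+1. w i j *\<^sub>R Lam U V i j) \<and>
        (\<forall>l\<in>{1..CARD('n)}. z $ idx l = (\<Sum>i<l. w i l)) \<and>
        (\<forall>l\<in>{0..CARD('n)+1}.
          (\<Sum>i<l. w i l) - (\<Sum>j=l+1..CARD('n)+1. w l j) =
            (if l = 0 then -1 else if l = CARD('n) + 1 then 1 else 0)))"
    (is "_ \<longleftrightarrow> (\<exists>W w. ?nonneg w \<and> ?psd W \<and> ?W W w \<and> ?z w \<and> ?bal w)") for x z \<tau>
  proof -
    have "unit_flow (CARD('n) + 1) 0 w \<longleftrightarrow> ?nonneg w \<and> ?bal w" for w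
      unfolding unit_flow_def balance ..
    then have "(W, z) \<in> inverse_hull \<longleftrightarrow> (\<exists>w. (?nonneg w \<and> ?bal w) \<and> ?W W w \<and> ?z w)" for W
      by (simp only: inverse_hull_iff)
    then show ?thesis
      by (intro ex_cong1) (simp only: ex_simps(1,2) conj_ac)
  qed
  then show ?thesis
    unfolding closure_hull_XB by presburger
qed

end
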